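(* Let $X\subset\mathbb P^{a_1}\times\mathbb P^{a_2}$ be a finite set of points. Then $X$ has the inclusion property with respect to $\pi_1$ if and only if $X$ has the $(\star)$-property.
   Context: We work over a field $k$ of characteristic zero. Let $\eta_1:\mathbb P^{a_1}\times\mathbb P^{a_2}\to\mathbb P^{a_1}$ be the projection to the first factor and $\pi_1:\mathbb P^{a_1}\times\mathbb P^{a_2}\to\mathbb P^{a_2}$ the projection omitting the first factor. Inclusion property: write $\eta_1(X)=\{P_1,\dots,P_t\}$ and let $X_j=\eta_1^{-1}(P_j)\cap X$ (the level sets of $X$). $X$ has the inclusion property with respect to $\pi_1$ if the collection of subsets $\{\pi_1(X_1),\dots,\pi_1(X_t)\}$ of $\mathbb P^{a_2}$ is totally ordered by inclusion and all its members are arithmetically Cohen-Macaulay (i.e. have Cohen-Macaulay homogeneous coordinate ring; this is automatic for finite sets of points in a projective space). $(\star)$-property: for any $(P_1,Q_1),(P_2,Q_2)\in X$, at least one of $(P_1,Q_2)$, $(P_2,Q_1)$ also belongs to $X$. *)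

theory Defs
  imports
    "HOL-Algebra.QuotRing"
    "HOL-Algebra.Ring_Divisibility"
    "HOL-Library.Poly_Mapping"
    "HOL-Library.Extended_Nat"
begin

section \<open>Projective space\<close>

text \<open>
  Vectors in $k^{a+1}$ are functions on the naturals that vanish beyond \<open>a\<close>.  A point of
  projective space is its set of homogeneous coordinate vectors, so equality of points is
  equality of sets.
\<close>

definition coord_vectors :: "nat \<Rightarrow> (nat \<Rightarrow> 'k::field) set" where
  "coord_vectors a = {v. (\<forall>i>a. v i = 0) \<and> v \<noteq> (\<lambda>_. 0)}"

definition proportional :: "nat \<Rightarrow> ((nat \<Rightarrow> 'k::field) \<times> (nat \<Rightarrow> 'k)) set" where
  "proportional a =
     {(v, w) \<in> coord_vectors a \<times> coord_vectors a. \<exists>c. c \<noteq> 0 \<and> w = (\<lambda>i. c * v i)}"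

definition proj_space :: "nat \<Rightarrow> (nat \<Rightarrow> 'k::field) set set" where
  "proj_space a = coord_vectors a // proportional a"

lemma equiv_proportional:
  "equiv (coord_vectors a) (proportional a :: ((nat \<Rightarrow> 'k::field) \<times> (nat \<Rightarrow> 'k)) set)"
proof (rule equivI)
  let ?r = "proportional a :: ((nat \<Rightarrow> 'k) \<times> (nat \<Rightarrow> 'k)) set"
  have intro: "(v, w) \<in> ?r"
    if "v \<in> coord_vectors a" "w \<in> coord_vectors a" "c \<noteq> 0" "\<And>i. w i = c * v i" for v w c
  proof -
    have "w = (\<lambda>i. c * v i)" using that(4) by (rule ext)
    then show ?thesis using that(1-3) unfolding proportional_def by blast
  qed
  have elim: "\<exists>c. v \<in> coord_vectors a \<and> w \<in> coord_vectors a \<and> c \<noteq> 0 \<and> (\<forall>i. w i = c * v i)"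
    if "(v, w) \<in> ?r" for v w
    using that unfolding proportional_def by (auto dest: fun_cong)
  show "?r \<subseteq> coord_vectors a \<times> coord_vectors a"
    unfolding proportional_def by blast
  show "refl_on (coord_vectors a) ?r"
  proof (rule refl_onI)
    fix v :: "nat \<Rightarrow> 'k" assume "v \<in> coord_vectors a"
    then show "(v, v) \<in> ?r" by (intro intro[where c = 1]) simp_all
  qed
  show "sym ?r"
  proof (rule symI)
    fix v w assume "(v, w) \<in> ?r"
    then obtain c where c: "v \<in> coord_vectors a" "w \<in> coord_vectors a" "c \<noteq> 0"
      "\<forall>i. w i = c * v i" using elim by blast
    show "(w, v) \<in> ?r"
      by (rule intro[where c = "inverse c"]) (use c in \<open>simp_all add: mult.assoc[symmetric]\<close>)
  qed
  show "trans ?r"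
  proof (rule transI)
    fix u v w assume uv: "(u, v) \<in> ?r" and vw: "(v, w) \<in> ?r"
    obtain c where c: "u \<in> coord_vectors a" "c \<noteq> 0" "\<forall>i. v i = c * u i"
      using elim[OF uv] by blast
    obtain d where d: "w \<in> coord_vectors a" "d \<noteq> 0" "\<forall>i. w i = d * v i"
      using elim[OF vw] by blast
    show "(u, w) \<in> ?r"
      by (rule intro[where c = "d * c"]) (use c d in \<open>simp_all add: mult.assoc\<close>)
  qed
qed


section \<open>Homogeneous coordinate rings\<close>

text \<open>A monomial is its exponent vector, a polynomial a finitely supported map from monomials
  to coefficients.\<close>

type_synonym 'k mpoly = "(nat \<Rightarrow>\<^sub>0 nat) \<Rightarrow>\<^sub>0 'k"

text \<open>\<open>poly_ring a\<close> is $k[x_0, \dots, x_a]$.\<close>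

definition poly_ring :: "nat \<Rightarrow> ('k::field) mpoly ring" where
  "poly_ring a =
     \<lparr> carrier = {p. \<forall>m \<in> Poly_Mapping.keys p. Poly_Mapping.keys m \<subseteq> {..a}},
       mult = (*), one = 1, zero = 0, add = (+) \<rparr>"

definition eval_mpoly :: "('k::field) mpoly \<Rightarrow> (nat \<Rightarrow> 'k) \<Rightarrow> 'k" where
  "eval_mpoly p v =
     (\<Sum>m \<in> Poly_Mapping.keys p.
        Poly_Mapping.lookup p m * (\<Prod>i \<in> Poly_Mapping.keys m. v i ^ Poly_Mapping.lookup m i))"

definition homogeneous :: "('k::field) mpoly \<Rightarrow> bool" where
  "homogeneous p \<longleftrightarrow>
     (\<exists>d. \<forall>m \<in> Poly_Mapping.keys p.
        (\<Sum>i \<in> Poly_Mapping.keys m. Poly_Mapping.lookup m i) = d)"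

definition vanishing_ideal :: "nat \<Rightarrow> (nat \<Rightarrow> 'k::field) set set \<Rightarrow> 'k mpoly set" where
  "vanishing_ideal a Y =
     Idl\<^bsub>poly_ring a\<^esub> {p \<in> carrier (poly_ring a).
       homogeneous p \<and> (\<forall>P \<in> Y. \<forall>v \<in> P. eval_mpoly p v = 0)}"

definition coordinate_ring :: "nat \<Rightarrow> (nat \<Rightarrow> 'k::field) set set \<Rightarrow> 'k mpoly set ring" where
  "coordinate_ring a Y = poly_ring a Quot vanishing_ideal a Y"

lemma cring_poly_ring: "cring (poly_ring a :: ('k::field) mpoly ring)"
proof (rule cringI)
  let ?S = "poly_ring a :: 'k mpoly ring"
  have add: "p + q \<in> carrier ?S" if "p \<in> carrier ?S" "q \<in> carrier ?S" for p q
    using that Poly_Mapping.keys_add[of p q] by (auto simp: poly_ring_def)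
  have uminus: "- p \<in> carrier ?S" if "p \<in> carrier ?S" for p
    using that by (auto simp: poly_ring_def in_keys_iff)
  have mult: "p * q \<in> carrier ?S" if p: "p \<in> carrier ?S" and q: "q \<in> carrier ?S" for p q
  proof -
    have "Poly_Mapping.keys m \<subseteq> {..a}" if mk: "m \<in> Poly_Mapping.keys (p * q)" for m
    proof -
      obtain m1 m2 where m: "m = m1 + m2" "m1 \<in> Poly_Mapping.keys p" "m2 \<in> Poly_Mapping.keys q"
        using mk Poly_Mapping.keys_mult[of p q] by blast
      then have "Poly_Mapping.keys m1 \<subseteq> {..a}" "Poly_Mapping.keys m2 \<subseteq> {..a}"
        using p q by (auto simp: poly_ring_def)
      then show ?thesis
        using m(1) Poly_Mapping.keys_add[of m1 m2] by blast
    qed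
    then show ?thesis by (simp add: poly_ring_def)
  qed
  have sel: "p \<oplus>\<^bsub>?S\<^esub> q = p + q" "p \<otimes>\<^bsub>?S\<^esub> q = p * q" "\<zero>\<^bsub>?S\<^esub> = 0" "\<one>\<^bsub>?S\<^esub> = 1" for p q
    by (simp_all add: poly_ring_def)
  have zero: "0 \<in> carrier ?S" and one: "1 \<in> carrier ?S"
    by (simp_all add: poly_ring_def)
  show "abelian_group ?S"
  proof (rule abelian_groupI)
    fix p assume "p \<in> carrier ?S"
    then show "\<exists>q \<in> carrier ?S. q \<oplus>\<^bsub>?S\<^esub> p = \<zero>\<^bsub>?S\<^esub>"
      using uminus[of p] by (intro bexI[of _ "- p"]) (simp_all add: sel)
  qed (simp_all add: sel add zero add.assoc add.commute)
  show "Group.comm_monoid ?S"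
    by (rule comm_monoidI) (simp_all add: sel mult one mult.assoc mult.commute)
  show "(p \<oplus>\<^bsub>?S\<^esub> q) \<otimes>\<^bsub>?S\<^esub> r = p \<otimes>\<^bsub>?S\<^esub> r \<oplus>\<^bsub>?S\<^esub> q \<otimes>\<^bsub>?S\<^esub> r" for p q r
    by (simp add: sel distrib_right)
qed

lemma cring_coordinate_ring: "cring (coordinate_ring a Y)"
proof -
  interpret cring "poly_ring a :: 'a mpoly ring" by (rule cring_poly_ring)
  have "ideal (vanishing_ideal a Y) (poly_ring a)"
    unfolding vanishing_ideal_def by (rule genideal_ideal) auto
  then show ?thesis
    unfolding coordinate_ring_def by (rule ideal.quotient_is_cring) (rule cring_poly_ring)
qed


section \<open>Cohen-Macaulay rings\<close>

definition regular_sequence :: "('a, 'b) ring_scheme \<Rightarrow> 'a list \<Rightarrow> bool" where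
  "regular_sequence R xs \<longleftrightarrow>
     set xs \<subseteq> carrier R \<and>
     Idl\<^bsub>R\<^esub> (set xs) \<noteq> carrier R \<and>
     (\<forall>i < length xs. \<forall>y \<in> carrier R.
        xs ! i \<otimes>\<^bsub>R\<^esub> y \<in> Idl\<^bsub>R\<^esub> (set (take i xs)) \<longrightarrow> y \<in> Idl\<^bsub>R\<^esub> (set (take i xs)))"

definition ideal_depth :: "('a, 'b) ring_scheme \<Rightarrow> 'a set \<Rightarrow> enat" where
  "ideal_depth R I = Sup {enat (length xs) | xs. regular_sequence R xs \<and> set xs \<subseteq> I}"

text \<open>Height (codimension) of a prime ideal.\<close>

definition prime_height :: "('a, 'b) ring_scheme \<Rightarrow> 'a set \<Rightarrow> enat" where
  "prime_height R P =
     Sup {enat n | n. \<exists>p :: nat \<Rightarrow> 'a set.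
       (\<forall>i \<le> n. primeideal (p i) R) \<and> (\<forall>i < n. p i \<subset> p (Suc i)) \<and> p n = P}"

text \<open>
  The non-local form of the definition (Eisenbud, \<^emph>\<open>Commutative Algebra\<close>, 18.2):
  a Noetherian ring in which every maximal ideal has depth equal to its codimension.
\<close>

definition cohen_macaulay_ring :: "('a, 'b) ring_scheme \<Rightarrow> bool" where
  "cohen_macaulay_ring R \<longleftrightarrow>
     cring R \<and> noetherian_ring R \<and>
     (\<forall>M. maximalideal M R \<longrightarrow> ideal_depth R M = prime_height R M)"

definition arithmetically_CM :: "nat \<Rightarrow> (nat \<Rightarrow> 'k::field) set set \<Rightarrow> bool" where
  "arithmetically_CM a Y \<longleftrightarrow> cohen_macaulay_ring (coordinate_ring a Y)"


section \<open>Subsets of a product of two projective spaces\<close>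

text \<open>
  The projection $\eta_1$ to the first factor is \<open>fst\<close>; the projection $\pi_1$ omitting the
  first factor is \<open>snd\<close>.
\<close>

definition level_set :: "('p \<times> 'q) set \<Rightarrow> 'p \<Rightarrow> ('p \<times> 'q) set" where
  "level_set X P = fst -` {P} \<inter> X"

text \<open>The argument \<open>a2\<close> is the dimension of the second factor, in which the sets
  $\pi_1(X_j)$ live.\<close>

definition inclusion_property ::
  "nat \<Rightarrow> ((nat \<Rightarrow> 'k::field) set \<times> (nat \<Rightarrow> 'k) set) set \<Rightarrow> bool" where
  "inclusion_property a2 X \<longleftrightarrow>
     chain\<^sub>\<subseteq> ((\<lambda>P. snd ` level_set X P) ` fst ` X) \<and>
     (\<forall>P \<in> fst ` X. arithmetically_CM a2 (snd ` level_set X P))"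

definition star_property :: "('p \<times> 'q) set \<Rightarrow> bool" where
  "star_property X \<longleftrightarrow>
     (\<forall>P1 Q1 P2 Q2. (P1, Q1) \<in> X \<longrightarrow> (P2, Q2) \<in> X \<longrightarrow> (P1, Q2) \<in> X \<or> (P2, Q1) \<in> X)"

end

theory Submission
  imports Defs "HOL-Computational_Algebra.Polynomial"
begin

text \<open>
  The two order conditions are equivalent by unfolding; the content is that finite sets $Y$ of
  points are arithmetically Cohen-Macaulay.  Choose a linear form $l$ vanishing at no point of $Y$
  and representatives $v_P$ with $l(v_P) = 1$.  Restriction to the lines $t \mapsto t v_P$ embeds
  the coordinate ring into $k[t]^Y$, and powers of $l$ map to the diagonal $k[t]$, so that the
  coordinate ring is a $k[t]$-subalgebra of $k[t]^Y$.  Any subalgebra $R$ of a finite power $A^Y$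
  of a Euclidean domain $A$ that is not a field is Cohen-Macaulay: its ideals are submodules of
  $A^Y$, hence finitely generated; each prime contains the kernel of a coordinate map to $A$, hence
  is the preimage of a prime of $A$, and maximal ideals have height 1 and contain a nonzero scalar,
  which is a nonzerodivisor.  There is no regular sequence $x, y$ in a maximal ideal $M$: the ideal
  $(x)$ contains a nonzero scalar $N = \pi^e b$, where $\pi$ generates $M \cap A$ and $b \notin M$;
  the characteristic polynomial of $y$ modulo $\pi$ gives $y^s g \in (\pi)$ with $g \notin M$,
  whence $y^{se} g^e b \in (x)$ and so $g^e b \in (x) \subseteq M$, which is absurd.
\<close>

section \<open>Euclidean domains and coefficients modulo an element\<close>

lemma euclidean_ideal_principal:
  fixes D :: "'b::euclidean_ring set"
  assumes zero: "0 \<in> D"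
    and add: "\<And>a b. a \<in> D \<Longrightarrow> b \<in> D \<Longrightarrow> a + b \<in> D"
    and mult: "\<And>a c. a \<in> D \<Longrightarrow> c * a \<in> D"
  shows "\<exists>\<pi>. D = {a. \<pi> dvd a}"
proof (cases "D = {0}")
  case True
  then show ?thesis by (intro exI[of _ 0]) auto
next
  case False
  then have "\<exists>a. a \<in> D \<and> a \<noteq> 0" using zero by auto
  then obtain \<pi> where \<pi>: "\<pi> \<in> D" "\<pi> \<noteq> 0"
    and min: "\<And>a. a \<in> D \<Longrightarrow> a \<noteq> 0 \<Longrightarrow> euclidean_size \<pi> \<le> euclidean_size a"
    using ex_has_least_nat[of "\<lambda>a. a \<in> D \<and> a \<noteq> 0" _ euclidean_size] by blast
  have "\<pi> dvd a" if "a \<in> D" for a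
  proof -
    have "a mod \<pi> = a + (- (a div \<pi>)) * \<pi>"
      using div_mult_mod_eq[of a \<pi>] by (simp add: algebra_simps)
    then have "a mod \<pi> \<in> D" using add[OF that mult[OF \<pi>(1)]] by metis
    then have "a mod \<pi> = 0" using min mod_size_less[OF \<pi>(2), of a] by fastforce
    then show ?thesis by (simp add: mod_eq_0_iff_dvd)
  qed
  moreover have "a \<in> D" if "\<pi> dvd a" for a
    using that mult[OF \<pi>(1)] by (auto simp: dvd_def mult.commute)
  ultimately show ?thesis by blast
qed

text \<open>Each cancellation of the non-unit \<open>\<pi>\<close> strictly lowers the Euclidean
  size, so splitting off factors stops.\<close>

lemma power_factor_exhaustion:
  fixes a \<pi> :: "'b::euclidean_ring"
  assumes "a \<noteq> 0" "\<not> is_unit \<pi>"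
  shows "\<exists>e b. a = \<pi> ^ e * b \<and> \<not> \<pi> dvd b"
  using assms(1)
proof (induction "euclidean_size a" arbitrary: a rule: less_induct)
  case less
  show ?case
  proof (cases "\<pi> dvd a")
    case True
    then obtain a' where a': "a = \<pi> * a'" by (auto elim: dvdE)
    with less.prems have "\<pi> \<noteq> 0" "a' \<noteq> 0" by auto
    then have "euclidean_size a' < euclidean_size a"
      unfolding a' using assms(2) by (intro euclidean_size_times_nonunit)
    with less.hyps \<open>a' \<noteq> 0\<close> obtain e b where "a' = \<pi> ^ e * b" "\<not> \<pi> dvd b" by blast
    then show ?thesis by (intro exI[of _ "Suc e"] exI[of _ b]) (simp add: a' mult.assoc)
  next
    case False
    then show ?thesis by (intro exI[of _ 0] exI[of _ a]) simp
  qed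
qed

text \<open>The coefficients are scanned from the constant term upwards: those divisible by
  \<open>\<pi>\<close> go into \<open>q\<close>, and the first one that is not becomes
  \<open>c\<close>. It exists, since otherwise \<open>\<pi>\<close> would divide all of
  \<open>p\<close>.\<close>

lemma poly_lowest_coeff_not_dvd:
  fixes p :: "'b::comm_ring_1 poly"
  assumes "\<not> [:\<pi>:] dvd p"
  shows "\<exists>s q c r. p = smult \<pi> q + monom 1 s * pCons c r \<and> \<not> \<pi> dvd c"
  using assms
proof (induction p)
  case 0
  then show ?case by simp
next
  case (pCons a p)
  show ?case
  proof (cases "\<pi> dvd a")
    case True
    then obtain a' where a': "a = \<pi> * a'" by (auto elim: dvdE)
    have "\<not> [:\<pi>:] dvd p"
    proof
      assume "[:\<pi>:] dvd p"
      then obtain p' where "p = smult \<pi> p'" by (auto elim: dvdE)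
      then have "pCons a p = [:\<pi>:] * pCons a' p'" by (simp add: a')
      with pCons.prems show False by (metis dvd_triv_left)
    qed
    with pCons.IH obtain s q c r where
      *: "p = smult \<pi> q + monom 1 s * pCons c r" "\<not> \<pi> dvd c" by blast
    have "pCons a p = smult \<pi> (pCons a' q) + monom 1 (Suc s) * pCons c r"
      by (simp add: *(1) a' monom_Suc)
    with *(2) show ?thesis by blast
  next
    case False
    have "pCons a p = smult \<pi> 0 + monom 1 0 * pCons a p" by simp
    with False show ?thesis by blast
  qed
qed

section \<open>Subalgebras of a finite power of a Euclidean domain\<close>

text \<open>Elements of \<open>R\<close> are handled as tuples through the jointly injective
  coordinates \<open>\<phi> i\<close>, and \<open>\<iota>\<close> embeds the scalars diagonally; its
  ring laws follow from \<open>eqI\<close>. The non-unit in \<open>not_field\<close> gives maximal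
  ideals height 1 instead of 0. For empty \<open>I\<close> the ring is zero and has no maximal
  ideals.\<close>

locale power_subalgebra = cring R for R :: "('a, 'm) ring_scheme" (structure) +
  fixes I :: "'i set"
    and \<phi> :: "'i \<Rightarrow> 'a \<Rightarrow> 'b::euclidean_ring"
    and \<iota> :: "'b \<Rightarrow> 'a"
  assumes finite_index: "finite I"
    and \<phi>_add: "\<lbrakk>i \<in> I; x \<in> carrier R; y \<in> carrier R\<rbrakk> \<Longrightarrow> \<phi> i (x \<oplus> y) = \<phi> i x + \<phi> i y"
    and \<phi>_mult: "\<lbrakk>i \<in> I; x \<in> carrier R; y \<in> carrier R\<rbrakk> \<Longrightarrow> \<phi> i (x \<otimes> y) = \<phi> i x * \<phi> i y"
    and \<phi>_one: "i \<in> I \<Longrightarrow> \<phi> i \<one> = 1"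
    and \<phi>_inj: "\<lbrakk>x \<in> carrier R; \<And>i. i \<in> I \<Longrightarrow> \<phi> i x = 0\<rbrakk> \<Longrightarrow> x = \<zero>"
    and \<iota>_closed [simp, intro]: "\<iota> a \<in> carrier R"
    and \<phi>_\<iota>: "i \<in> I \<Longrightarrow> \<phi> i (\<iota> a) = a"
    and not_field: "\<exists>a::'b. a \<noteq> 0 \<and> \<not> is_unit a"
begin

lemma \<phi>_zero: "i \<in> I \<Longrightarrow> \<phi> i \<zero> = 0"
proof -
  assume "i \<in> I"
  then have "\<phi> i \<zero> + 0 = \<phi> i \<zero> + \<phi> i \<zero>" using \<phi>_add[of i \<zero> \<zero>] by simp
  then show ?thesis by (simp only: add_left_cancel)
qed

lemma \<phi>_uminus: "i \<in> I \<Longrightarrow> x \<in> carrier R \<Longrightarrow> \<phi> i (\<ominus> x) = - \<phi> i x"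
  using \<phi>_add[of i x "\<ominus> x"] by (simp add: \<phi>_zero r_neg eq_neg_iff_add_eq_0 add.commute)

lemma \<phi>_diff: "i \<in> I \<Longrightarrow> x \<in> carrier R \<Longrightarrow> y \<in> carrier R \<Longrightarrow> \<phi> i (x \<ominus> y) = \<phi> i x - \<phi> i y"
  by (simp add: a_minus_def \<phi>_add \<phi>_uminus)

lemma \<phi>_pow: "i \<in> I \<Longrightarrow> x \<in> carrier R \<Longrightarrow> \<phi> i (x [^] (n::nat)) = \<phi> i x ^ n"
  by (induction n) (simp_all add: \<phi>_one \<phi>_mult mult.commute)

lemmas \<phi>_simps = \<phi>_add \<phi>_mult \<phi>_one \<phi>_zero \<phi>_uminus \<phi>_diff \<phi>_pow \<phi>_\<iota>

lemma eqI: "\<lbrakk>x \<in> carrier R; y \<in> carrier R; \<And>i. i \<in> I \<Longrightarrow> \<phi> i x = \<phi> i y\<rbrakk> \<Longrightarrow> x = y"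
  using \<phi>_inj[of "x \<ominus> y"] by (simp add: \<phi>_diff)

lemma \<iota>_zero: "\<iota> 0 = \<zero>" and \<iota>_one: "\<iota> 1 = \<one>"
  and \<iota>_add: "\<iota> (a + b) = \<iota> a \<oplus> \<iota> b" and \<iota>_mult: "\<iota> (a * b) = \<iota> a \<otimes> \<iota> b"
  by (rule eqI; simp add: \<phi>_simps)+

text \<open>Horner's scheme. It places polynomials in \<open>y\<close> with scalar coefficients
  inside \<open>R\<close>, so that polynomial identities can be checked coordinate by
  coordinate.\<close>

lemma polynomial_value:
  assumes "y \<in> carrier R"
  shows "\<exists>z \<in> carrier R. \<forall>i \<in> I. \<phi> i z = poly p (\<phi> i y)"
proof (induction p)
  case 0
  show ?case by (intro bexI[of _ \<zero>]) (simp_all add: \<phi>_simps)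
next
  case (pCons a p)
  then obtain z where "z \<in> carrier R" "\<forall>i \<in> I. \<phi> i z = poly p (\<phi> i y)" by blast
  with assms show ?case
    by (intro bexI[of _ "\<iota> a \<oplus> y \<otimes> z"]) (simp_all add: \<phi>_simps)
qed

section \<open>Finite generation of ideals\<close>

lemma ideal_diff: "ideal J R \<Longrightarrow> x \<in> J \<Longrightarrow> y \<in> J \<Longrightarrow> x \<ominus> y \<in> J"
  by (simp add: a_minus_def additive_subgroup.a_closed additive_subgroup.a_inv_closed ideal.axioms(1))

text \<open>Generators are collected one coordinate at a time. Among the elements of
  \<open>J\<close> vanishing on \<open>K\<close>, the values at a new coordinate \<open>k\<close>
  form an ideal of the Euclidean domain, so one further generator suffices.\<close>

lemma ideal_finitely_generated:
  assumes J: "ideal J R"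
  shows "\<exists>A \<subseteq> carrier R. finite A \<and> J = Idl A"
proof -
  interpret J: ideal J R by (rule J)
  \<comment> \<open>Elements of \<open>J\<close> are matched only on \<open>K\<close>; for
    \<open>K = I\<close> joint injectivity turns the agreement into equality.\<close>
  have "K \<subseteq> I \<Longrightarrow>
      \<exists>A \<subseteq> J. finite A \<and> (\<forall>f \<in> J. \<exists>g \<in> Idl A. \<forall>i \<in> K. \<phi> i f = \<phi> i g)"
    if "finite K" for K
    using that
  proof (induction K rule: finite_induct)
    case empty
    have "\<zero> \<in> Idl {}" by (intro additive_subgroup.zero_closed ideal.axioms(1) genideal_ideal) auto
    then show ?case by (intro exI[of _ "{}"]) auto
  next
    case (insert k K)
    then obtain A where A: "A \<subseteq> J" "finite A"
      and IH: "\<And>f. f \<in> J \<Longrightarrow> \<exists>g \<in> Idl A. \<forall>i \<in> K. \<phi> i f = \<phi> i g" by blast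
    define D where "D = {\<phi> k f |f. f \<in> J \<and> (\<forall>i \<in> K. \<phi> i f = 0)}"
    have "\<exists>\<pi>. D = {a. \<pi> dvd a}"
    proof (rule euclidean_ideal_principal)
      show "0 \<in> D" unfolding D_def using insert.prems
        by (intro CollectI exI[of _ \<zero>]) (auto simp: \<phi>_zero)
      show "a + b \<in> D" if "a \<in> D" "b \<in> D" for a b
      proof -
        obtain f g where "f \<in> J" "g \<in> J" "a = \<phi> k f" "b = \<phi> k g"
          "\<forall>i \<in> K. \<phi> i f = 0" "\<forall>i \<in> K. \<phi> i g = 0"
          using \<open>a \<in> D\<close> \<open>b \<in> D\<close> unfolding D_def by auto
        then show ?thesis unfolding D_def using insert.prems J.a_closed
          by (intro CollectI exI[of _ "f \<oplus> g"]) (auto simp: \<phi>_add subsetD)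
      qed
      show "c * a \<in> D" if "a \<in> D" for a c
      proof -
        obtain f where "f \<in> J" "a = \<phi> k f" "\<forall>i \<in> K. \<phi> i f = 0"
          using \<open>a \<in> D\<close> unfolding D_def by auto
        then show ?thesis unfolding D_def using insert.prems J.I_l_closed
          by (intro CollectI exI[of _ "\<iota> c \<otimes> f"]) (auto simp: \<phi>_mult \<phi>_\<iota> subsetD)
      qed
    qed
    then obtain \<pi> where \<pi>: "D = {a. \<pi> dvd a}" by blast
    then have "\<pi> \<in> D" by simp
    then obtain f0 where f0: "f0 \<in> J" "\<pi> = \<phi> k f0" "\<forall>i \<in> K. \<phi> i f0 = 0"
      unfolding D_def by auto
    let ?A = "Set.insert f0 A"
    have sub: "?A \<subseteq> carrier R" using f0 A J.Icarr by blast
    interpret A: ideal "Idl ?A" R by (rule genideal_ideal[OF sub])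
    have IA: "Idl A \<subseteq> Idl ?A"
      using sub genideal_self[OF sub] by (intro genideal_minimal A.ideal_axioms) auto
    have "Idl A \<subseteq> J" using A by (intro genideal_minimal J)
    have "\<exists>g \<in> Idl ?A. \<forall>i \<in> Set.insert k K. \<phi> i f = \<phi> i g" if f: "f \<in> J" for f
    proof -
      obtain g where g: "g \<in> Idl A" "\<forall>i \<in> K. \<phi> i f = \<phi> i g" using IH[OF f] by blast
      have gJ: "g \<in> J" using g \<open>Idl A \<subseteq> J\<close> by blast
      \<comment> \<open>The difference vanishes on \<open>K\<close>, so its value at
        \<open>k\<close> is a multiple of \<open>\<pi>\<close>. A scalar multiple of
        \<open>f0\<close> corrects coordinate \<open>k\<close> and changes nothing on
        \<open>K\<close>.\<close>
      have "\<phi> k (f \<ominus> g) \<in> D" unfolding D_def using ideal_diff[OF J f gJ] g insert.prems f gJ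
        by (intro CollectI exI[of _ "f \<ominus> g"]) (auto simp: \<phi>_diff subsetD)
      then obtain c where "\<phi> k (f \<ominus> g) = \<pi> * c" using \<pi> by (auto elim: dvdE)
      then have c: "\<phi> k f = \<phi> k g + c * \<pi>"
        using f gJ insert.prems by (simp add: \<phi>_diff algebra_simps)
      have "g \<oplus> \<iota> c \<otimes> f0 \<in> Idl ?A"
        using IA g genideal_self[OF sub] by (intro A.a_closed A.I_l_closed) auto
      moreover have "\<forall>i \<in> Set.insert k K. \<phi> i f = \<phi> i (g \<oplus> \<iota> c \<otimes> f0)"
        using c g f0 insert.prems gJ by (auto simp: \<phi>_simps subsetD)
      ultimately show ?thesis by blast
    qed
    then show ?case using A f0 by (intro exI[of _ ?A]) auto
  qed
  from this[OF finite_index subset_refl] obtain A where A: "A \<subseteq> J" "finite A"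
    "\<And>f. f \<in> J \<Longrightarrow> \<exists>g \<in> Idl A. \<forall>i \<in> I. \<phi> i f = \<phi> i g" by blast
  have Ac: "A \<subseteq> carrier R" using A J.Icarr by blast
  have "Idl A \<subseteq> J" using A J by (intro genideal_minimal)
  moreover have "J \<subseteq> Idl A"
  proof
    fix f assume f: "f \<in> J"
    then obtain g where g: "g \<in> Idl A" "\<forall>i \<in> I. \<phi> i f = \<phi> i g" using A by blast
    then have "f = g" using f \<open>Idl A \<subseteq> J\<close> by (intro eqI) auto
    with g show "f \<in> Idl A" by simp
  qed
  ultimately show ?thesis using Ac A(2) by blast
qed

lemma noetherian: "noetherian_ring R"
  using ideal_finitely_generated by unfold_locales

section \<open>Prime and maximal ideals\<close>

definition coord_kernel :: "'i \<Rightarrow> 'a set"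
  where "coord_kernel i = {x \<in> carrier R. \<phi> i x = 0}"

lemma coord_kernel_prime:
  assumes i: "i \<in> I"
  shows "primeideal (coord_kernel i) R"
proof (rule primeidealI[OF idealI])
  show "subgroup (coord_kernel i) (add_monoid R)"
    using i by (auto intro!: subgroup.intro simp: coord_kernel_def \<phi>_simps simp flip: a_inv_def)
  show "carrier R \<noteq> coord_kernel i"
    using i \<phi>_one[OF i] one_closed unfolding coord_kernel_def by force
qed (use i in \<open>auto simp: coord_kernel_def \<phi>_simps ring_axioms cring_axioms\<close>)

text \<open>If each kernel had an element outside \<open>p\<close>, the product of these would stay
  outside \<open>p\<close> by primality, yet vanish in every coordinate and so be zero.\<close>

lemma prime_contains_coord_kernel:
  assumes p: "primeideal p R"
  shows "\<exists>i \<in> I. coord_kernel i \<subseteq> p"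
proof (rule ccontr)
  interpret p: primeideal p R by (rule p)
  assume neg: "\<not> ?thesis"
  have "K \<subseteq> I \<Longrightarrow> \<exists>f \<in> carrier R - p. \<forall>i \<in> K. \<phi> i f = 0" if "finite K" for K
    using that
  proof (induction K rule: finite_induct)
    case empty
    then show ?case using p.I_notcarr p.a_subset by blast
  next
    case (insert k K)
    then obtain f where f: "f \<in> carrier R - p" "\<forall>i \<in> K. \<phi> i f = 0" by blast
    obtain g where g: "g \<in> coord_kernel k" "g \<notin> p" using neg insert.prems by blast
    then have "f \<otimes> g \<in> carrier R - p" using f p.I_prime[of f g] by (auto simp: coord_kernel_def)
    then show ?case using f g insert.prems
      by (intro bexI[of _ "f \<otimes> g"]) (auto simp: \<phi>_simps coord_kernel_def subsetD)
  qed
  from this[OF finite_index subset_refl] obtain f where "f \<in> carrier R - p" "\<forall>i \<in> I. \<phi> i f = 0"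
    by blast
  then show False using \<phi>_inj[of f] p.zero_closed by auto
qed

text \<open>Modulo the kernel, \<open>x\<close> is congruent to the scalar
  \<open>\<iota> (\<phi> i x)\<close>. Hence \<open>p\<close> is determined by the scalars in it,
  and these form a principal ideal.\<close>

lemma prime_over_coord_kernel:
  assumes p: "primeideal p R" and i: "i \<in> I" and sub: "coord_kernel i \<subseteq> p"
  shows "\<exists>\<pi>. \<not> is_unit \<pi> \<and> p = {x \<in> carrier R. \<pi> dvd \<phi> i x}"
proof -
  interpret p: primeideal p R by (rule p)
  have "\<exists>\<pi>. {a. \<iota> a \<in> p} = {a. \<pi> dvd a}"
    by (rule euclidean_ideal_principal)
      (auto simp: \<iota>_zero \<iota>_add \<iota>_mult intro: p.I_l_closed p.a_closed)
  then obtain \<pi> where "{a. \<iota> a \<in> p} = {a. \<pi> dvd a}" by blast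
  then have \<pi>: "\<iota> a \<in> p \<longleftrightarrow> \<pi> dvd a" for a by blast
  have "x \<in> p \<longleftrightarrow> \<iota> (\<phi> i x) \<in> p" if x: "x \<in> carrier R" for x
  proof -
    have d: "x \<ominus> \<iota> (\<phi> i x) \<in> p"
      using sub x i by (auto simp: coord_kernel_def \<phi>_simps)
    have "x = (x \<ominus> \<iota> (\<phi> i x)) \<oplus> \<iota> (\<phi> i x)" "\<iota> (\<phi> i x) = x \<ominus> (x \<ominus> \<iota> (\<phi> i x))"
      using x by (auto intro!: eqI simp: \<phi>_simps)
    then show ?thesis using d p.a_closed ideal_diff[OF p.ideal_axioms] by metis
  qed
  then have "p = {x \<in> carrier R. \<pi> dvd \<phi> i x}" using \<pi> p.a_subset by blast
  moreover have "\<not> is_unit \<pi>"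
  proof
    assume "is_unit \<pi>"
    then have "\<one> \<in> p" using \<pi>[of 1] by (simp add: \<iota>_one)
    then show False using p.one_imp_carrier p.I_notcarr by blast
  qed
  ultimately show ?thesis by blast
qed

text \<open>A kernel inside \<open>p0\<close> lies in all three primes, so \<open>p1\<close> and
  \<open>p2\<close> are given by \<open>\<pi>1\<close> and \<open>\<pi>2\<close> at the same
  coordinate, with \<open>\<pi>1\<close> nonzero by the first strict inclusion. Primality of
  \<open>p1\<close> applied to \<open>\<pi>1 = \<pi>2 * c\<close> forces
  \<open>p2 \<subseteq> p1\<close> or makes \<open>\<pi>2\<close> a unit.\<close>

lemma prime_chain_length:
  assumes p: "primeideal p0 R" "primeideal p1 R" "primeideal p2 R" and "p0 \<subset> p1" "p1 \<subset> p2"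
  shows False
proof -
  interpret p1: primeideal p1 R by (rule p)
  obtain i where i: "i \<in> I" "coord_kernel i \<subseteq> p0" using prime_contains_coord_kernel[OF p(1)] by blast
  then have sub: "coord_kernel i \<subseteq> p1" "coord_kernel i \<subseteq> p2" using assms by auto
  obtain \<pi>1 where \<pi>1: "p1 = {x \<in> carrier R. \<pi>1 dvd \<phi> i x}"
    using prime_over_coord_kernel[OF p(2) i(1) sub(1)] by blast
  obtain \<pi>2 where \<pi>2: "\<not> is_unit \<pi>2" "p2 = {x \<in> carrier R. \<pi>2 dvd \<phi> i x}"
    using prime_over_coord_kernel[OF p(3) i(1) sub(2)] by blast
  have mem1: "\<iota> a \<in> p1 \<longleftrightarrow> \<pi>1 dvd a" for a unfolding \<pi>1 using i(1) by (simp add: \<phi>_\<iota>)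
  have mem2: "\<iota> a \<in> p2 \<longleftrightarrow> \<pi>2 dvd a" for a unfolding \<pi>2(2) using i(1) by (simp add: \<phi>_\<iota>)
  have "\<pi>1 \<noteq> 0"
  proof
    assume "\<pi>1 = 0"
    then have "p1 = coord_kernel i" unfolding \<pi>1 coord_kernel_def by simp
    with i(2) \<open>p0 \<subset> p1\<close> show False by blast
  qed
  have "\<iota> \<pi>1 \<in> p1" unfolding mem1 by simp
  with \<open>p1 \<subset> p2\<close> have "\<iota> \<pi>1 \<in> p2" by blast
  then obtain c where c: "\<pi>1 = \<pi>2 * c" unfolding mem2 by (rule dvdE)
  have "\<iota> \<pi>2 \<otimes> \<iota> c \<in> p1" using mem1[of "\<pi>2 * c"] by (simp add: \<iota>_mult c)
  then consider "\<iota> \<pi>2 \<in> p1" | "\<iota> c \<in> p1" using p1.I_prime by blast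
  then show False
  proof cases
    case 1
    then have "\<pi>1 dvd \<pi>2" unfolding mem1 .
    then have "p2 \<subseteq> p1" unfolding \<pi>1 \<pi>2(2) using dvd_trans[OF \<open>\<pi>1 dvd \<pi>2\<close>] by blast
    with \<open>p1 \<subset> p2\<close> show False by blast
  next
    case 2
    then obtain d where d: "c = \<pi>1 * d" unfolding mem1 by (rule dvdE)
    have "\<pi>1 * (\<pi>2 * d) = \<pi>2 * c" unfolding d by (simp add: mult_ac)
    also have "\<dots> = \<pi>1 * 1" using c by simp
    finally have "\<pi>2 * d = 1" using \<open>\<pi>1 \<noteq> 0\<close> by (simp only: mult_cancel_left simp_thms)
    then show False using \<pi>2(1) by (metis dvd_triv_left)
  qed
qed

text \<open>If \<open>\<pi>\<close> were 0, \<open>M\<close> would be a coordinate kernel, strictly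
  inside the proper ideal of elements whose coordinate \<open>i\<close> is divisible by a nonzero
  non-unit.\<close>

lemma maximal_ideal_representation:
  assumes M: "maximalideal M R"
  obtains i \<pi> where "i \<in> I" "\<not> is_unit \<pi>" "\<pi> \<noteq> 0" "M = {x \<in> carrier R. \<pi> dvd \<phi> i x}"
proof -
  interpret M: maximalideal M R by (rule M)
  have prime: "primeideal M R" by (rule maximalideal_prime[OF M])
  obtain i where i: "i \<in> I" "coord_kernel i \<subseteq> M" using prime_contains_coord_kernel[OF prime] by blast
  obtain \<pi> where \<pi>: "\<not> is_unit \<pi>" "M = {x \<in> carrier R. \<pi> dvd \<phi> i x}"
    using prime_over_coord_kernel[OF prime i] by blast
  have "\<pi> \<noteq> 0"
  proof
    assume "\<pi> = 0"
    obtain t :: 'b where t: "t \<noteq> 0" "\<not> is_unit t" using not_field by blast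
    let ?J = "{x \<in> carrier R. t dvd \<phi> i x}"
    have "ideal ?J R"
    proof (rule idealI)
      show "subgroup ?J (add_monoid R)"
        using i by (auto intro!: subgroup.intro simp: \<phi>_simps simp flip: a_inv_def)
    qed (use i in \<open>auto simp: \<phi>_simps ring_axioms\<close>)
    moreover have "M \<subseteq> ?J" unfolding \<pi>(2) \<open>\<pi> = 0\<close> by auto
    ultimately have "?J = M \<or> ?J = carrier R" by (intro M.I_maximal) auto
    moreover have "\<iota> t \<in> ?J" using i by (simp add: \<phi>_\<iota>)
    moreover have "\<iota> t \<notin> M" unfolding \<pi>(2) \<open>\<pi> = 0\<close> using i t by (simp add: \<phi>_\<iota>)
    moreover have "\<one> \<notin> ?J" using i t by (auto simp: \<phi>_one)
    ultimately show False by blast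
  qed
  with i \<pi> that show ?thesis by blast
qed

lemma prime_height_maximal:
  assumes M: "maximalideal M R"
  shows "prime_height R M = 1"
proof -
  let ?S = "{enat n | n. \<exists>p :: nat \<Rightarrow> 'a set.
       (\<forall>i \<le> n. primeideal (p i) R) \<and> (\<forall>i < n. p i \<subset> p (Suc i)) \<and> p n = M}"
  have "s \<le> 1" if "s \<in> ?S" for s
  proof -
    obtain n and p :: "nat \<Rightarrow> 'a set" where n: "s = enat n" "\<forall>i \<le> n. primeideal (p i) R"
      "\<forall>i < n. p i \<subset> p (Suc i)" using \<open>s \<in> ?S\<close> by blast
    have "n \<le> 1"
    proof (rule ccontr)
      assume "\<not> n \<le> 1"
      then show False using n prime_chain_length[of "p 0" "p 1" "p 2"]
        by (auto simp: numeral_2_eq_2)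
    qed
    then show ?thesis by (simp add: n one_enat_def)
  qed
  moreover have "1 \<in> ?S"
  proof -
    obtain i \<pi> where i: "i \<in> I" "\<pi> \<noteq> 0" "M = {x \<in> carrier R. \<pi> dvd \<phi> i x}"
      using maximal_ideal_representation[OF M] by metis
    \<comment> \<open>This scalar separates \<open>M\<close> from a prime below it, so a chain of
      length 1 exists.\<close>
    have "\<iota> \<pi> \<in> M - coord_kernel i" using i by (auto simp: \<phi>_\<iota> coord_kernel_def)
    then have "coord_kernel i \<subset> M" using i by (auto simp: coord_kernel_def)
    then show ?thesis using coord_kernel_prime[OF i(1)] maximalideal_prime[OF M]
      unfolding one_enat_def
      by (intro CollectI exI[of _ 1] conjI refl exI[of _ "\<lambda>j. if j = 0 then coord_kernel i else M"])
        auto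
  qed
  ultimately show ?thesis unfolding prime_height_def
    by (intro antisym Sup_least Sup_upper)
qed

section \<open>Regular sequences and depth\<close>

lemma genideal_empty: "Idl {} = {\<zero>}"
  using genideal_minimal[OF zeroideal, of "{}"]
    additive_subgroup.zero_closed[OF ideal.axioms(1)[OF genideal_ideal[of "{}"]]] by auto

lemma genideal_singleton: "x \<in> carrier R \<Longrightarrow> Idl {x} = {y \<otimes> x |y. y \<in> carrier R}"
  by (simp add: cgenideal_eq_genideal[symmetric] cgenideal_def)

text \<open>The constant coefficient of the product of the factors \<open>T - \<phi> i x\<close> over the coordinates
  where \<open>x\<close> does not vanish is a multiple of \<open>x\<close>, because the product annihilates \<open>x\<close>.\<close>

lemma nonzerodivisor_divides_scalar:
  assumes x: "x \<in> carrier R"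
    and reg: "\<And>y. y \<in> carrier R \<Longrightarrow> x \<otimes> y = \<zero> \<Longrightarrow> y = \<zero>"
  obtains N where "N \<noteq> 0" "\<iota> N \<in> Idl {x}"
proof -
  define J where "J = {i \<in> I. \<phi> i x \<noteq> 0}"
  have finJ: "finite J" using finite_index by (simp add: J_def)
  \<comment> \<open>Outside \<open>J\<close> the element \<open>x\<close> vanishes, so anything
    vanishing on \<open>J\<close> is annihilated by \<open>x\<close>.\<close>
  have J_inj: "y = \<zero>" if y: "y \<in> carrier R" "\<And>i. i \<in> J \<Longrightarrow> \<phi> i y = 0" for y
  proof -
    have "x \<otimes> y = \<zero>" using x y by (intro \<phi>_inj) (auto simp: \<phi>_simps J_def)
    then show ?thesis using reg y by blast
  qed
  define p where "p = (\<Prod>i\<in>J. [:- \<phi> i x, 1:])"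
  obtain c q where cq: "p = pCons c q" by (cases p)
  obtain z where z: "z \<in> carrier R" "\<forall>i \<in> I. \<phi> i z = poly q (\<phi> i x)"
    using polynomial_value[OF x] by blast
  \<comment> \<open>The value at 0 is the product of the nonzero factors \<open>- \<phi> i x\<close>
    over \<open>J\<close>.\<close>
  have "poly p 0 \<noteq> 0" by (simp add: p_def poly_prod finJ) (auto simp: J_def)
  then have "c \<noteq> 0" by (simp add: cq)
  have "\<iota> c \<oplus> z \<otimes> x = \<zero>"
  proof (rule J_inj)
    show "\<iota> c \<oplus> z \<otimes> x \<in> carrier R" using x z by simp
    fix i assume i: "i \<in> J"
    then have "poly p (\<phi> i x) = 0" using finJ by (auto simp: p_def poly_prod prod_zero_iff)
    then show "\<phi> i (\<iota> c \<oplus> z \<otimes> x) = 0"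
      using i x z by (simp add: \<phi>_simps cq J_def mult.commute)
  qed
  then have "\<iota> c = (\<ominus> z) \<otimes> x"
    using x z by (simp add: l_minus minus_equality)
  then have "\<iota> c \<in> Idl {x}" using x z by (auto simp: genideal_singleton)
  with \<open>c \<noteq> 0\<close> that show thesis by blast
qed

text \<open>Reducing the characteristic polynomial of \<open>y\<close> modulo \<open>\<pi>\<close> and splitting off the highest power
  of the variable writes a power of \<open>y\<close> times an element outside \<open>M\<close> as a multiple of \<open>\<pi>\<close>.\<close>

lemma power_in_scalar_ideal:
  assumes i: "i \<in> I" and \<pi>: "\<not> is_unit \<pi>" and M: "M = {x \<in> carrier R. \<pi> dvd \<phi> i x}"
    and y: "y \<in> M"
  obtains s g h where "g \<in> carrier R - M" "h \<in> carrier R" "y [^] (s::nat) \<otimes> g = \<iota> \<pi> \<otimes> h"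
proof -
  have yc: "y \<in> carrier R" "\<pi> dvd \<phi> i y" using y M by auto
  define p where "p = (\<Prod>i\<in>I. [:- \<phi> i y, 1:])"
  have "lead_coeff p = 1" by (simp add: p_def lead_coeff_prod)
  \<comment> \<open>A non-unit cannot divide the leading coefficient 1.\<close>
  have "\<not> [:\<pi>:] dvd p"
  proof
    assume "[:\<pi>:] dvd p"
    then have "\<pi> dvd lead_coeff p" by (simp add: const_poly_dvd_iff)
    with \<pi> \<open>lead_coeff p = 1\<close> show False by simp
  qed
  then obtain s q c r where p: "p = smult \<pi> q + monom 1 s * pCons c r" and c: "\<not> \<pi> dvd c"
    using poly_lowest_coeff_not_dvd by blast
  obtain a where a: "a \<in> carrier R" "\<forall>i \<in> I. \<phi> i a = poly q (\<phi> i y)"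
    using polynomial_value yc by blast
  obtain b where b: "b \<in> carrier R" "\<forall>i \<in> I. \<phi> i b = poly r (\<phi> i y)"
    using polynomial_value yc by blast
  let ?g = "\<iota> c \<oplus> y \<otimes> b"
  have gc: "?g \<in> carrier R" using yc b by simp
  \<comment> \<open>Since \<open>y\<close> is in \<open>M\<close>, the second summand is divisible
    by \<open>\<pi>\<close> at \<open>i\<close>, whereas \<open>c\<close> is not.\<close>
  have "\<not> \<pi> dvd \<phi> i ?g"
    using c yc i b by (simp add: \<phi>_simps dvd_add_left_iff)
  moreover have "y [^] s \<otimes> ?g = \<iota> \<pi> \<otimes> (\<ominus> a)"
  proof (rule eqI)
    fix j assume j: "j \<in> I"
    \<comment> \<open>Cayley-Hamilton in coordinates: every coordinate of \<open>y\<close> is a root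
      of \<open>p\<close>.\<close>
    then have "poly p (\<phi> j y) = 0" using finite_index by (auto simp: p_def poly_prod prod_zero_iff)
    then have "\<pi> * poly q (\<phi> j y) + \<phi> j y ^ s * (c + \<phi> j y * poly r (\<phi> j y)) = 0"
      by (simp add: p poly_monom algebra_simps)
    then show "\<phi> j (y [^] s \<otimes> ?g) = \<phi> j (\<iota> \<pi> \<otimes> (\<ominus> a))"
      using j yc a b by (simp add: \<phi>_simps add_eq_0_iff add.commute)
  qed (use yc a b in simp_all)
  ultimately show thesis using that[of ?g "\<ominus> a" s] gc a M by simp
qed

lemma no_regular_pair:
  assumes M: "maximalideal M R" and xM: "x \<in> M" and yM: "y \<in> M"
    and x_reg: "\<And>z. z \<in> carrier R \<Longrightarrow> x \<otimes> z = \<zero> \<Longrightarrow> z = \<zero>"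
    and y_reg: "\<And>z. z \<in> carrier R \<Longrightarrow> y \<otimes> z \<in> Idl {x} \<Longrightarrow> z \<in> Idl {x}"
  shows False
proof -
  interpret M: primeideal M R by (rule maximalideal_prime[OF M])
  obtain i \<pi> where i: "i \<in> I" and \<pi>: "\<not> is_unit \<pi>" and M_eq: "M = {x \<in> carrier R. \<pi> dvd \<phi> i x}"
    using maximal_ideal_representation[OF M] by metis
  have x: "x \<in> carrier R" and y: "y \<in> carrier R" using xM yM M.Icarr by auto
  interpret X: ideal "Idl {x}" R using x by (intro genideal_ideal) auto
  obtain N where N: "N \<noteq> 0" "\<iota> N \<in> Idl {x}"
    using nonzerodivisor_divides_scalar[OF x x_reg] by blast
  obtain e b where eb: "N = \<pi> ^ e * b" "\<not> \<pi> dvd b"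
    using power_factor_exhaustion[OF N(1) \<pi>] by blast
  obtain s g h where g: "g \<in> carrier R - M" and h: "h \<in> carrier R"
    and gh: "y [^] (s::nat) \<otimes> g = \<iota> \<pi> \<otimes> h"
    using power_in_scalar_ideal[OF i \<pi> M_eq yM] by blast
  \<comment> \<open>Regularity of \<open>y\<close> modulo \<open>x\<close>, iterated, cancels all
    powers of \<open>y\<close>.\<close>
  have cancel: "y [^] n \<otimes> z \<in> Idl {x} \<Longrightarrow> z \<in> Idl {x}" if "z \<in> carrier R" for z and n :: nat
    using that
  proof (induction n)
    case (Suc n)
    then have "y \<otimes> (y [^] n \<otimes> z) \<in> Idl {x}" using y by (simp add: m_assoc m_lcomm)
    moreover have "y [^] n \<otimes> z \<in> carrier R" using Suc.prems(2) y by blast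
    ultimately have "y [^] n \<otimes> z \<in> Idl {x}" using y_reg by blast
    then show ?case using Suc by blast
  qed simp
  \<comment> \<open>The relation \<open>gh\<close> is raised to the power \<open>e\<close> and
    multiplied by \<open>\<iota> b\<close>, so that \<open>\<pi> ^ e * b\<close> becomes
    \<open>N\<close>, whose image lies in \<open>Idl {x}\<close>.\<close>
  have "y [^] (s * e) \<otimes> (g [^] e \<otimes> \<iota> b) = \<iota> N \<otimes> h [^] e"
  proof (rule eqI)
    fix j assume j: "j \<in> I"
    have "\<phi> j (y [^] s \<otimes> g) = \<phi> j (\<iota> \<pi> \<otimes> h)" using gh by simp
    then have "\<phi> j y ^ s * \<phi> j g = \<pi> * \<phi> j h" using j y g h by (simp add: \<phi>_simps)
    then have "\<phi> j y ^ (s * e) * \<phi> j g ^ e = \<pi> ^ e * \<phi> j h ^ e"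
      by (metis power_mult power_mult_distrib)
    then have "\<phi> j y ^ (s * e) * \<phi> j g ^ e * b = \<pi> ^ e * \<phi> j h ^ e * b" by simp
    then show "\<phi> j (y [^] (s * e) \<otimes> (g [^] e \<otimes> \<iota> b)) = \<phi> j (\<iota> N \<otimes> h [^] e)"
      using j y g h by (simp add: \<phi>_simps eb mult_ac)
  qed (use y g h in simp_all)
  moreover have "\<iota> N \<otimes> h [^] e \<in> Idl {x}" using N h by (intro X.I_r_closed) auto
  ultimately have "y [^] (s * e) \<otimes> (g [^] e \<otimes> \<iota> b) \<in> Idl {x}" by (simp only:)
  moreover have "g [^] e \<otimes> \<iota> b \<in> carrier R" using g by simp
  ultimately have "g [^] e \<otimes> \<iota> b \<in> Idl {x}" by (rule cancel[rotated])
  moreover have "Idl {x} \<subseteq> M" using xM by (intro genideal_minimal M.ideal_axioms) auto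
  ultimately have mem: "g [^] e \<otimes> \<iota> b \<in> M" by blast
  \<comment> \<open>Neither factor of the product in \<open>mem\<close> lies in the prime ideal
    \<open>M\<close>.\<close>
  have "\<iota> b \<notin> M" unfolding M_eq using i eb by (simp add: \<phi>_\<iota>)
  moreover have "g [^] n \<notin> M" for n :: nat
  proof (induction n)
    case 0
    then show ?case using M.one_imp_carrier M.I_notcarr by auto
  next
    case (Suc n)
    then show ?case using g M.I_prime[of "g [^] n" g] by auto
  qed
  moreover have "g [^] e \<in> carrier R" using g by simp
  ultimately show False using M.I_prime[OF _ \<iota>_closed mem] by blast
qed

lemma ideal_depth_maximal:
  assumes M: "maximalideal M R"
  shows "ideal_depth R M = 1"
proof -
  interpret M: maximalideal M R by (rule M)
  let ?S = "{enat (length xs) | xs. regular_sequence R xs \<and> set xs \<subseteq> M}"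
  have "s \<le> 1" if "s \<in> ?S" for s
  proof -
    obtain xs where xs: "s = enat (length xs)" "regular_sequence R xs" "set xs \<subseteq> M" using \<open>s \<in> ?S\<close> by blast
    have "length xs \<le> 1"
    proof (rule ccontr)
      assume "\<not> length xs \<le> 1"
      then obtain x y zs where eq: "xs = x # y # zs"
        by (cases xs; cases "tl xs") auto
      have reg: "xs ! i \<otimes> z \<in> Idl (set (take i xs)) \<Longrightarrow> z \<in> Idl (set (take i xs))"
        if "i < length xs" "z \<in> carrier R" for i z
        using xs(2) that unfolding regular_sequence_def by blast
      show False
      \<comment> \<open>Index 0 gives regularity modulo the zero ideal \<open>Idl {}\<close>, index
        1 modulo \<open>Idl {x}\<close>.\<close>
      proof (rule no_regular_pair[OF M, of x y])
        show "z = \<zero>" if "z \<in> carrier R" "x \<otimes> z = \<zero>" for z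
          using reg[of 0 z] that by (simp add: eq genideal_empty)
        show "z \<in> Idl {x}" if "z \<in> carrier R" "y \<otimes> z \<in> Idl {x}" for z
          using reg[of 1 z] that by (simp add: eq)
      qed (use xs eq in auto)
    qed
    then show ?thesis by (simp add: xs one_enat_def)
  qed
  moreover have "1 \<in> ?S"
  proof -
    obtain i \<pi> where i: "i \<in> I" "\<pi> \<noteq> 0" "M = {x \<in> carrier R. \<pi> dvd \<phi> i x}"
      using maximal_ideal_representation[OF M] by metis
    \<comment> \<open>A nonzero scalar is nonzero in every coordinate, hence a nonzerodivisor: it
      forms a regular sequence of length 1.\<close>
    have mem: "\<iota> \<pi> \<in> M" unfolding i(3) using i(1) by (simp add: \<phi>_\<iota>)
    have "Idl {\<iota> \<pi>} \<subseteq> M" using mem by (intro genideal_minimal M.ideal_axioms) auto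
    then have "Idl {\<iota> \<pi>} \<noteq> carrier R" using M.I_notcarr M.a_subset by blast
    moreover have "y = \<zero>" if "y \<in> carrier R" "\<iota> \<pi> \<otimes> y = \<zero>" for y
    proof (rule \<phi>_inj)
      fix j assume j: "j \<in> I"
      then have "\<pi> * \<phi> j y = 0" using arg_cong[OF that(2), of "\<phi> j"] that(1) by (simp add: \<phi>_simps)
      then show "\<phi> j y = 0" using i by simp
    qed (use that in simp)
    ultimately have "regular_sequence R [\<iota> \<pi>]"
      unfolding regular_sequence_def by (simp add: genideal_empty)
    with mem show ?thesis unfolding one_enat_def
      by (intro CollectI exI[of _ "[\<iota> \<pi>]"]) simp
  qed
  ultimately show ?thesis unfolding ideal_depth_def
    by (intro antisym Sup_least Sup_upper)
qed

lemma cohen_macaulay: "cohen_macaulay_ring R"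
  unfolding cohen_macaulay_ring_def
  using cring_axioms noetherian ideal_depth_maximal prime_height_maximal by simp

end

section \<open>The coordinate ring of a finite set of points\<close>

definition monomial_degree :: "(nat \<Rightarrow>\<^sub>0 nat) \<Rightarrow> nat"
  where "monomial_degree m = (\<Sum>i \<in> Poly_Mapping.keys m. Poly_Mapping.lookup m i)"

definition monomial_value :: "(nat \<Rightarrow> 'k::field) \<Rightarrow> (nat \<Rightarrow>\<^sub>0 nat) \<Rightarrow> 'k"
  where "monomial_value v m = (\<Prod>i \<in> Poly_Mapping.keys m. v i ^ Poly_Mapping.lookup m i)"

text \<open>\<open>ray_poly v p\<close> is the univariate polynomial $p(t v)$.\<close>

definition ray_poly :: "(nat \<Rightarrow> 'k::field) \<Rightarrow> 'k mpoly \<Rightarrow> 'k poly"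
  where "ray_poly v p = (\<Sum>m \<in> Poly_Mapping.keys p.
    monom (Poly_Mapping.lookup p m * monomial_value v m) (monomial_degree m))"

text \<open>Comparing \<open>m\<close>, \<open>n\<close> and \<open>m + n\<close> needs sums over
  one common index set.\<close>

lemma monomial_degree_superset:
  assumes "finite S" "Poly_Mapping.keys m \<subseteq> S"
  shows "monomial_degree m = (\<Sum>i \<in> S. Poly_Mapping.lookup m i)"
  unfolding monomial_degree_def using assms by (intro sum.mono_neutral_left) (auto simp: in_keys_iff)

lemma monomial_value_superset:
  assumes "finite S" "Poly_Mapping.keys m \<subseteq> S"
  shows "monomial_value v m = (\<Prod>i \<in> S. v i ^ Poly_Mapping.lookup m i)"
  unfolding monomial_value_def using assms by (intro prod.mono_neutral_left) (auto simp: in_keys_iff)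

lemma monomial_degree_add: "monomial_degree (m + n) = monomial_degree m + monomial_degree n"
proof -
  let ?S = "Poly_Mapping.keys m \<union> Poly_Mapping.keys n"
  have "monomial_degree x = (\<Sum>i \<in> ?S. Poly_Mapping.lookup x i)" if "x \<in> {m, n, m + n}" for x
    using that Poly_Mapping.keys_add[of m n] by (intro monomial_degree_superset) auto
  then show ?thesis by (simp add: lookup_add sum.distrib)
qed

lemma monomial_value_add: "monomial_value v (m + n) = monomial_value v m * monomial_value v n"
proof -
  let ?S = "Poly_Mapping.keys m \<union> Poly_Mapping.keys n"
  have "monomial_value v x = (\<Prod>i \<in> ?S. v i ^ Poly_Mapping.lookup x i)" if "x \<in> {m, n, m + n}" for x
    using that Poly_Mapping.keys_add[of m n] by (intro monomial_value_superset) auto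
  then show ?thesis by (simp add: lookup_add power_add prod.distrib)
qed

lemma monomial_value_scale:
  "monomial_value (\<lambda>i. c * v i) m = c ^ monomial_degree m * monomial_value v m"
  by (simp add: monomial_value_def monomial_degree_def power_mult_distrib prod.distrib power_sum)

lemma ray_poly_superset:
  assumes "finite S" "Poly_Mapping.keys p \<subseteq> S"
  shows "ray_poly v p =
    (\<Sum>m \<in> S. monom (Poly_Mapping.lookup p m * monomial_value v m) (monomial_degree m))"
  unfolding ray_poly_def using assms by (intro sum.mono_neutral_left) (auto simp: in_keys_iff)

lemma ray_poly_zero [simp]: "ray_poly v 0 = 0"
  by (simp add: ray_poly_def)

lemma ray_poly_single:
  "ray_poly v (Poly_Mapping.single m c) = monom (c * monomial_value v m) (monomial_degree m)"
  by (subst ray_poly_superset[of "{m}"]) auto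

lemma ray_poly_const: "ray_poly v (Poly_Mapping.single 0 c) = [:c:]"
  by (simp add: ray_poly_single monomial_value_def monomial_degree_def monom_0)

lemma ray_poly_one [simp]: "ray_poly v 1 = 1"
  using ray_poly_const[of v 1] by simp

lemma ray_poly_add: "ray_poly v (p + q) = ray_poly v p + ray_poly v q"
proof -
  let ?S = "Poly_Mapping.keys p \<union> Poly_Mapping.keys q"
  have "ray_poly v x =
      (\<Sum>m \<in> ?S. monom (Poly_Mapping.lookup x m * monomial_value v m) (monomial_degree m))"
    if "x \<in> {p, q, p + q}" for x
    using that Poly_Mapping.keys_add[of p q] by (intro ray_poly_superset) auto
  then show ?thesis by (simp add: lookup_add distrib_right add_monom[symmetric] sum.distrib)
qed

lemma ray_poly_uminus: "ray_poly v (- p) = - ray_poly v p"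
  using ray_poly_add[of v p "- p"] by (simp add: eq_neg_iff_add_eq_0 add.commute)

lemma ray_poly_diff: "ray_poly v (p - q) = ray_poly v p - ray_poly v q"
  using ray_poly_add[of v "p - q" q] by (simp add: eq_diff_eq)

lemma ray_poly_sum: "ray_poly v (\<Sum>i\<in>S. f i) = (\<Sum>i\<in>S. ray_poly v (f i))"
  by (induction S rule: infinite_finite_induct) (simp_all add: ray_poly_add)

lemma mpoly_expansion:
  "p = (\<Sum>m \<in> Poly_Mapping.keys p. Poly_Mapping.single m (Poly_Mapping.lookup p m))"
  by (rule poly_mapping_eqI)
    (auto simp: lookup_sum lookup_single when_def in_keys_iff)

text \<open>Expansion into monomials reduces this to additivity of the degree and multiplicativity
  of the value.\<close>

lemma ray_poly_mult: "ray_poly v (p * q) = ray_poly v p * ray_poly v q"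
proof -
  have "p * q = (\<Sum>m \<in> Poly_Mapping.keys p. \<Sum>n \<in> Poly_Mapping.keys q.
      Poly_Mapping.single (m + n) (Poly_Mapping.lookup p m * Poly_Mapping.lookup q n))"
    by (subst mpoly_expansion[of p], subst mpoly_expansion[of q]) (simp add: sum_product mult_single)
  then have "ray_poly v (p * q) = (\<Sum>m \<in> Poly_Mapping.keys p. \<Sum>n \<in> Poly_Mapping.keys q.
      monom (Poly_Mapping.lookup p m * Poly_Mapping.lookup q n * monomial_value v (m + n))
        (monomial_degree (m + n)))"
    by (simp add: ray_poly_sum ray_poly_single)
  also have "\<dots> = ray_poly v p * ray_poly v q"
    by (simp add: ray_poly_def sum_product mult_monom monomial_value_add monomial_degree_add mult_ac)
  finally show ?thesis .
qed

lemma poly_ray_poly: "poly (ray_poly v p) c = eval_mpoly p (\<lambda>i. c * v i)"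
  by (simp add: ray_poly_def eval_mpoly_def poly_sum poly_monom monomial_value_scale mult_ac
      flip: monomial_value_def)

lemma homogeneous_iff:
  "homogeneous p \<longleftrightarrow> (\<exists>d. \<forall>m \<in> Poly_Mapping.keys p. monomial_degree m = d)"
  by (simp add: homogeneous_def monomial_degree_def)

section \<open>Polynomial ring operations and homogeneous parts\<close>

lemma poly_ring_simps [simp]:
  "p \<oplus>\<^bsub>poly_ring a\<^esub> q = p + q" "p \<otimes>\<^bsub>poly_ring a\<^esub> q = p * q"
  "\<zero>\<^bsub>poly_ring a\<^esub> = 0" "\<one>\<^bsub>poly_ring a\<^esub> = 1"
  by (simp_all add: poly_ring_def)

lemma poly_ring_zero_one_closed [simp]:
  "0 \<in> carrier (poly_ring a)" "1 \<in> carrier (poly_ring a)"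
  by (simp_all add: poly_ring_def)

lemma poly_ring_a_inv:
  assumes "p \<in> carrier (poly_ring a)"
  shows "\<ominus>\<^bsub>poly_ring a\<^esub> p = - p"
proof -
  interpret cring "poly_ring a :: 'a mpoly ring" by (rule cring_poly_ring)
  have "- p \<in> carrier (poly_ring a)" using assms by (auto simp: poly_ring_def in_keys_iff)
  then show ?thesis using assms by (intro minus_equality) simp_all
qed

lemma poly_ring_diff:
  assumes "p \<in> carrier (poly_ring a)" "q \<in> carrier (poly_ring a)"
  shows "p \<ominus>\<^bsub>poly_ring a\<^esub> q = p - q"
  using assms by (simp add: a_minus_def poly_ring_a_inv)

definition homogeneous_part :: "nat \<Rightarrow> 'k::field mpoly \<Rightarrow> 'k mpoly"
  where "homogeneous_part d p = (\<Sum>m \<in> {m \<in> Poly_Mapping.keys p. monomial_degree m = d}.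
    Poly_Mapping.single m (Poly_Mapping.lookup p m))"

lemma lookup_homogeneous_part:
  "Poly_Mapping.lookup (homogeneous_part d p) m =
    (if monomial_degree m = d then Poly_Mapping.lookup p m else 0)"
  by (auto simp: homogeneous_part_def lookup_sum lookup_single when_def in_keys_iff)

lemma keys_homogeneous_part:
  "Poly_Mapping.keys (homogeneous_part d p) = {m \<in> Poly_Mapping.keys p. monomial_degree m = d}"
  by (auto simp: in_keys_iff lookup_homogeneous_part split: if_splits)

lemma homogeneous_homogeneous_part: "homogeneous (homogeneous_part d p)"
  by (auto simp: homogeneous_iff keys_homogeneous_part)

lemma sum_homogeneous_parts:
  "p = (\<Sum>d \<in> monomial_degree ` Poly_Mapping.keys p. homogeneous_part d p)"
  by (subst mpoly_expansion) (simp add: homogeneous_part_def sum.image_gen[where g = monomial_degree])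

text \<open>Monomials of degree \<open>d\<close> contribute only to the power \<open>t^d\<close>. So
  a polynomial restricting to zero on a ray has all its homogeneous parts zero there.\<close>

lemma ray_poly_homogeneous_part:
  "ray_poly v (homogeneous_part d p) = monom (coeff (ray_poly v p) d) d"
proof -
  have "coeff (ray_poly v p) d =
      (\<Sum>m \<in> Poly_Mapping.keys p. if monomial_degree m = d
        then Poly_Mapping.lookup p m * monomial_value v m else 0)"
    by (simp add: ray_poly_def coeff_sum)
  also have "\<dots> = (\<Sum>m \<in> {m \<in> Poly_Mapping.keys p. monomial_degree m = d}.
      Poly_Mapping.lookup p m * monomial_value v m)"
    by (simp add: sum.inter_filter)
  finally show ?thesis
    by (simp add: homogeneous_part_def ray_poly_sum ray_poly_single monom_sum)
qed

section \<open>Representatives of points and the vanishing ideal\<close>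

lemma proj_point_scale:
  assumes "P \<in> proj_space a" "v \<in> P"
  shows "w \<in> P \<longleftrightarrow> (\<exists>c. c \<noteq> 0 \<and> w = (\<lambda>i. c * v i))"
proof -
  obtain u where u: "u \<in> coord_vectors a" "P = proportional a `` {u}"
    using assms(1) unfolding proj_space_def by (auto elim: quotientE)
  have "P = proportional a `` {v}"
    using assms(2) equiv_class_eq[OF equiv_proportional, of u v a] unfolding u by auto
  moreover have "v \<in> coord_vectors a" using assms(2) u by (auto simp: proportional_def)
  ultimately show ?thesis
    by (auto simp: proportional_def coord_vectors_def fun_eq_iff)
qed

lemma proj_point_nonempty: "P \<in> proj_space a \<Longrightarrow> \<exists>v \<in> P. v \<in> coord_vectors a"
  unfolding proj_space_def using equiv_class_self[OF equiv_proportional] by (blast elim: quotientE)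

lemma proj_point_coord_vectors: "P \<in> proj_space a \<Longrightarrow> v \<in> P \<Longrightarrow> v \<in> coord_vectors a"
  unfolding proj_space_def by (auto elim!: quotientE simp: proportional_def)

text \<open>The coefficients of the form are $1, s, \dots, s^a$ for a general \<open>s\<close>.\<close>

lemma separating_linear_form:
  fixes V :: "(nat \<Rightarrow> 'k::field_char_0) set"
  assumes "finite V" "V \<subseteq> coord_vectors a"
  shows "\<exists>c. \<forall>v \<in> V. (\<Sum>i\<le>a. c i * v i) \<noteq> 0"
proof -
  define f where "f v = (\<Sum>i\<le>a. monom (v i) i)" for v :: "nat \<Rightarrow> 'k"
  have "f v \<noteq> 0" if v: "v \<in> V" for v
  proof
    assume "f v = 0"
    have "v i = 0" for i
    proof (cases "i \<le> a")
      case True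
      then have "coeff (f v) i = v i" by (simp add: f_def coeff_sum)
      with \<open>f v = 0\<close> show ?thesis by simp
    next
      case False
      then show ?thesis using v assms(2) by (auto simp: coord_vectors_def)
    qed
    then have "v = (\<lambda>_. 0)" by auto
    then show False using v assms(2) by (auto simp: coord_vectors_def)
  qed
  then have "(\<Prod>v\<in>V. f v) \<noteq> 0" using assms(1) by simp
  \<comment> \<open>The value of \<open>f v\<close> at \<open>s\<close> is the linear form at
    \<open>v\<close>. A nonzero polynomial has a non-root because the field is infinite.\<close>
  then obtain s where "poly (\<Prod>v\<in>V. f v) s \<noteq> 0" using poly_all_0_iff_0 by blast
  then have "\<forall>v \<in> V. (\<Sum>i\<le>a. s ^ i * v i) \<noteq> 0"
    using assms(1) by (simp add: poly_prod f_def poly_sum poly_monom mult.commute)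
  then show ?thesis by blast
qed

text \<open>The polynomials that vanish on the chosen rays form an ideal containing the homogeneous
  generators. Conversely, the homogeneous parts of such a polynomial are themselves
  generators.\<close>

lemma vanishing_ideal_iff:
  fixes Y :: "(nat \<Rightarrow> 'k::field_char_0) set set"
  assumes Y: "Y \<subseteq> proj_space a" and v: "\<And>P. P \<in> Y \<Longrightarrow> v P \<in> P"
  shows "p \<in> vanishing_ideal a Y \<longleftrightarrow>
    p \<in> carrier (poly_ring a) \<and> (\<forall>P \<in> Y. ray_poly (v P) p = 0)"
proof -
  interpret S: cring "poly_ring a :: 'k mpoly ring" by (rule cring_poly_ring)
  define G :: "'k mpoly set" where "G = {p \<in> carrier (poly_ring a).
       homogeneous p \<and> (\<forall>P \<in> Y. \<forall>v \<in> P. eval_mpoly p v = 0)}"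
  define K where "K = {p \<in> carrier (poly_ring a). \<forall>P \<in> Y. ray_poly (v P) p = 0}"
  have G_car: "G \<subseteq> carrier (poly_ring a)" by (auto simp: G_def)
  interpret VI: ideal "Idl\<^bsub>poly_ring a\<^esub> G" "poly_ring a" by (rule S.genideal_ideal[OF G_car])
  have "ideal K (poly_ring a)"
  proof (rule idealI)
    show "subgroup K (add_monoid (poly_ring a))"
    proof (rule subgroup.intro)
      show "inv\<^bsub>add_monoid (poly_ring a)\<^esub> x \<in> K" if "x \<in> K" for x
        using that S.a_inv_closed[of x] unfolding a_inv_def[symmetric]
        by (simp add: K_def poly_ring_a_inv ray_poly_uminus)
    qed (use S.a_closed in \<open>auto simp: K_def ray_poly_add\<close>)
  qed (use S.m_closed in \<open>auto simp: K_def ray_poly_mult S.ring_axioms\<close>)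
  moreover have "G \<subseteq> K"
  proof
    fix p assume p: "p \<in> G"
    have "ray_poly (v P) p = 0" if P: "P \<in> Y" for P
    proof (rule ccontr)
      assume "ray_poly (v P) p \<noteq> 0"
      then have "finite {c. poly (ray_poly (v P) p) c = 0}" by (rule poly_roots_finite)
      \<comment> \<open>Only nonzero multiples of \<open>v P\<close> represent \<open>P\<close>, so
        the roots are shown to cover all scalars but 0, still an infinite set.\<close>
      moreover have "poly (ray_poly (v P) p) c = 0" if "c \<noteq> 0" for c
      proof -
        have "(\<lambda>i. c * v P i) \<in> P" using that proj_point_scale[of P a "v P"] Y P v by blast
        with p P show ?thesis by (auto simp: G_def poly_ray_poly)
      qed
      then have "UNIV - {0} \<subseteq> {c. poly (ray_poly (v P) p) c = 0}" by auto
      ultimately have "finite (UNIV - {0::'k})" by (rule finite_subset[rotated])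
      then show False using infinite_UNIV_char_0[where 'a='k] by simp
    qed
    then show "p \<in> K" using p by (auto simp: K_def G_def)
  qed
  ultimately have "Idl\<^bsub>poly_ring a\<^esub> G \<subseteq> K" by (rule S.genideal_minimal)
  moreover have "K \<subseteq> Idl\<^bsub>poly_ring a\<^esub> G"
  proof
    fix p assume p: "p \<in> K"
    have part: "homogeneous_part d p \<in> Idl\<^bsub>poly_ring a\<^esub> G" for d
    proof -
      have "eval_mpoly (homogeneous_part d p) w = 0" if P: "P \<in> Y" and w: "w \<in> P" for P w
      proof -
        obtain c where c: "w = (\<lambda>i. c * v P i)" using proj_point_scale[of P a "v P"] Y P v w by blast
        have "ray_poly (v P) (homogeneous_part d p) = 0"
          using p P by (simp add: ray_poly_homogeneous_part K_def)
        then show ?thesis using poly_ray_poly[of "v P" "homogeneous_part d p" c] by (simp add: c)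
      qed
      moreover have "homogeneous_part d p \<in> carrier (poly_ring a)"
        using p by (auto simp: K_def poly_ring_def keys_homogeneous_part)
      ultimately have "homogeneous_part d p \<in> G"
        by (simp add: G_def homogeneous_homogeneous_part)
      then show ?thesis using S.genideal_self[OF G_car] by blast
    qed
    have "(\<Sum>d\<in>D. homogeneous_part d p) \<in> Idl\<^bsub>poly_ring a\<^esub> G" if "finite D" for D
      using that
    proof (induction D rule: finite_induct)
      case empty
      then show ?case using VI.zero_closed by simp
    next
      case (insert d D)
      then show ?case using VI.a_closed[OF part] by simp
    qed
    then show "p \<in> Idl\<^bsub>poly_ring a\<^esub> G"
      by (subst sum_homogeneous_parts) simp
  qed
  ultimately have "Idl\<^bsub>poly_ring a\<^esub> G = K" by (rule subset_antisym)
  then show ?thesis unfolding vanishing_ideal_def G_def[symmetric] by (simp only: K_def mem_Collect_eq)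
qed

text \<open>A linear form with value 1 at every \<open>v P\<close> restricts to \<open>t\<close> on
  all rays at once. Horner's scheme in this form realizes \<open>f\<close> on them simultaneously,
  which yields the diagonal copy of k[t].\<close>

lemma ray_poly_section:
  fixes v :: "'p \<Rightarrow> nat \<Rightarrow> 'k::field"
  assumes v: "\<And>P. P \<in> Y \<Longrightarrow> (\<Sum>i\<le>a. c i * v P i) = 1"
  shows "\<exists>p \<in> carrier (poly_ring a). \<forall>P \<in> Y. ray_poly (v P) p = f"
proof (induction f)
  case 0
  show ?case by (intro bexI[of _ 0]) (auto simp: poly_ring_def)
next
  case (pCons b f)
  interpret S: cring "poly_ring a :: 'k mpoly ring" by (rule cring_poly_ring)
  obtain p where p: "p \<in> carrier (poly_ring a)" "\<forall>P \<in> Y. ray_poly (v P) p = f"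
    using pCons.IH by blast
  define l :: "'k mpoly" where "l = (\<Sum>i\<le>a. Poly_Mapping.single (Poly_Mapping.single i 1) (c i))"
  have l_ray: "ray_poly (v P) l = [:0, 1:]" if "P \<in> Y" for P
  proof -
    have "ray_poly (v P) l = (\<Sum>i\<le>a. monom (c i * v P i) 1)"
      by (simp add: l_def ray_poly_sum ray_poly_single monomial_value_def monomial_degree_def)
    also have "\<dots> = monom 1 1" using v[OF that] by (simp add: monom_sum[symmetric])
    finally show ?thesis by (simp add: monom_altdef)
  qed
  have "l \<in> carrier (poly_ring a)"
  proof -
    have "Poly_Mapping.keys m \<subseteq> {..a}" if m: "m \<in> Poly_Mapping.keys l" for m
    proof -
      obtain i where "i \<le> a"
        "m \<in> Poly_Mapping.keys (Poly_Mapping.single (Poly_Mapping.single i (1::nat)) (c i))"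
        using keys_sum m unfolding l_def by fast
      then show ?thesis by (auto split: if_splits)
    qed
    then show ?thesis by (simp add: poly_ring_def)
  qed
  moreover have "Poly_Mapping.single 0 b \<in> carrier (poly_ring a)"
    by (simp add: poly_ring_def)
  ultimately have "Poly_Mapping.single 0 b + l * p \<in> carrier (poly_ring a)"
    using S.a_closed[OF _ S.m_closed[OF _ p(1)]] by simp
  moreover have "\<forall>P \<in> Y. ray_poly (v P) (Poly_Mapping.single 0 b + l * p) = pCons b f"
    using p l_ray by (simp add: ray_poly_add ray_poly_const ray_poly_mult)
  ultimately show ?case by blast
qed

section \<open>Finite point sets are arithmetically Cohen-Macaulay\<close>

lemma finite_points_arithmetically_CM:
  fixes Y :: "(nat \<Rightarrow> 'k::field_char_0) set set"
  assumes Y: "Y \<subseteq> proj_space a" and fin: "finite Y"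
  shows "arithmetically_CM a Y"
proof -
  interpret S: cring "poly_ring a :: 'k mpoly ring" by (rule cring_poly_ring)
  have "\<forall>P \<in> Y. \<exists>v. v \<in> P" using proj_point_nonempty Y by blast
  then obtain u where u: "\<And>P. P \<in> Y \<Longrightarrow> u P \<in> P" by metis
  have "u ` Y \<subseteq> coord_vectors a" using u Y proj_point_coord_vectors by blast
  then obtain c where c: "\<And>P. P \<in> Y \<Longrightarrow> (\<Sum>i\<le>a. c i * u P i) \<noteq> 0"
    using separating_linear_form[of "u ` Y" a] fin by auto
  \<comment> \<open>Rescaling normalizes the linear form to 1 at each representative, as
    \<open>ray_poly_section\<close> requires.\<close>
  define v where "v P i = inverse (\<Sum>i\<le>a. c i * u P i) * u P i" for P i
  have vP: "v P \<in> P" if "P \<in> Y" for P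
  proof -
    have "\<exists>b. b \<noteq> 0 \<and> v P = (\<lambda>i. b * u P i)"
      using c[OF that] by (intro exI[of _ "inverse (\<Sum>i\<le>a. c i * u P i)"]) (auto simp: v_def fun_eq_iff)
    then show ?thesis using proj_point_scale[of P a "u P" "v P"] that Y u by blast
  qed
  have v1: "(\<Sum>i\<le>a. c i * v P i) = 1" if "P \<in> Y" for P
  proof -
    have "(\<Sum>i\<le>a. c i * v P i) = inverse (\<Sum>i\<le>a. c i * u P i) * (\<Sum>i\<le>a. c i * u P i)"
      unfolding v_def sum_distrib_left by (simp add: mult_ac)
    then show ?thesis using c[OF that] by simp
  qed
  let ?V = "vanishing_ideal a Y"
  note V_iff = vanishing_ideal_iff[OF Y vP]
  interpret V: ideal ?V "poly_ring a"
    unfolding vanishing_ideal_def by (rule S.genideal_ideal) auto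
  define cls where "cls p = ?V +>\<^bsub>poly_ring a\<^esub> p" for p
  \<comment> \<open>A representative of the coset is chosen; by \<open>cls_eq\<close> the value does
    not depend on it.\<close>
  define \<phi> where "\<phi> P C = ray_poly (v P) (SOME p. p \<in> carrier (poly_ring a) \<and> cls p = C)" for P C
  have car: "carrier (coordinate_ring a Y) = cls ` carrier (poly_ring a)"
    by (auto simp: coordinate_ring_def FactRing_def A_RCOSETS_def' cls_def)
  have cls_eq: "cls p = cls q \<longleftrightarrow> (\<forall>P \<in> Y. ray_poly (v P) p = ray_poly (v P) q)"
    if "p \<in> carrier (poly_ring a)" "q \<in> carrier (poly_ring a)" for p q
    using S.quotient_eq_iff_same_a_r_cos[OF V.ideal_axioms that] that S.minus_closed[OF that]
    by (auto simp: cls_def V_iff poly_ring_diff ray_poly_diff)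
  have \<phi>_cls: "\<phi> P (cls p) = ray_poly (v P) p" if "P \<in> Y" "p \<in> carrier (poly_ring a)" for P p
  proof -
    let ?q = "SOME q. q \<in> carrier (poly_ring a) \<and> cls q = cls p"
    have "?q \<in> carrier (poly_ring a) \<and> cls ?q = cls p"
      using that(2) by (intro someI[of "\<lambda>q. q \<in> carrier (poly_ring a) \<and> cls q = cls p" p]) simp
    then show ?thesis using cls_eq[of ?q p] that by (simp add: \<phi>_def)
  qed
  have add: "cls p \<oplus>\<^bsub>coordinate_ring a Y\<^esub> cls q = cls (p + q)"
    if "p \<in> carrier (poly_ring a)" "q \<in> carrier (poly_ring a)" for p q
    using V.a_rcos_sum[OF that] by (simp add: coordinate_ring_def FactRing_def cls_def)
  have mult: "cls p \<otimes>\<^bsub>coordinate_ring a Y\<^esub> cls q = cls (p * q)"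
    if "p \<in> carrier (poly_ring a)" "q \<in> carrier (poly_ring a)" for p q
    using V.rcoset_mult_add[OF that] by (simp add: coordinate_ring_def FactRing_def cls_def)
  have one: "\<one>\<^bsub>coordinate_ring a Y\<^esub> = cls 1"
    by (simp add: coordinate_ring_def FactRing_def cls_def)
  have zero: "\<zero>\<^bsub>coordinate_ring a Y\<^esub> = cls 0"
    using S.a_rcos_zero[OF V.ideal_axioms V.zero_closed]
    by (simp add: coordinate_ring_def FactRing_def cls_def)
  have sumc: "p + q \<in> carrier (poly_ring a)" and prodc: "p * q \<in> carrier (poly_ring a)"
    if "p \<in> carrier (poly_ring a)" "q \<in> carrier (poly_ring a)" for p q :: "'k mpoly"
    using S.a_closed[OF that] S.m_closed[OF that] by simp_all
  have "\<exists>p. p \<in> carrier (poly_ring a) \<and> (\<forall>P \<in> Y. ray_poly (v P) p = f)" for f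
    using ray_poly_section[where v = v and a = a and c = c and Y = Y and f = f] v1 by blast
  then obtain sec where sec: "\<And>f. sec f \<in> carrier (poly_ring a)"
    "\<And>f P. P \<in> Y \<Longrightarrow> ray_poly (v P) (sec f) = f" by metis
  interpret R: cring "coordinate_ring a Y" by (rule cring_coordinate_ring)
  interpret power_subalgebra "coordinate_ring a Y" Y \<phi> "\<lambda>f. cls (sec f)"
  \<comment> \<open>Writing carrier elements as \<open>cls p\<close> turns the obligations into
    statements about polynomials.\<close>
  proof (unfold_locales; (elim imageE | clarsimp simp only: car)?)
    show "finite Y" by (rule fin)
    show "\<exists>f :: 'k poly. f \<noteq> 0 \<and> \<not> is_unit f"
      by (intro exI[of _ "[:0, 1:]"]) (simp add: is_unit_pCons_iff)
    show "\<phi> P (cls p \<oplus>\<^bsub>coordinate_ring a Y\<^esub> cls q) = \<phi> P (cls p) + \<phi> P (cls q)"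
      if "P \<in> Y" "p \<in> carrier (poly_ring a)" "q \<in> carrier (poly_ring a)" for P p q
      using that by (simp add: add \<phi>_cls sumc ray_poly_add)
    show "\<phi> P (cls p \<otimes>\<^bsub>coordinate_ring a Y\<^esub> cls q) = \<phi> P (cls p) * \<phi> P (cls q)"
      if "P \<in> Y" "p \<in> carrier (poly_ring a)" "q \<in> carrier (poly_ring a)" for P p q
      using that by (simp add: mult \<phi>_cls prodc ray_poly_mult)
    show "\<phi> P \<one>\<^bsub>coordinate_ring a Y\<^esub> = 1" if "P \<in> Y" for P
      using that by (simp add: one \<phi>_cls)
    show "cls p = \<zero>\<^bsub>coordinate_ring a Y\<^esub>"
      if "\<And>P. P \<in> Y \<Longrightarrow> \<phi> P (cls p) = 0" "p \<in> carrier (poly_ring a)" for p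
      using that by (simp add: zero cls_eq \<phi>_cls)
    show "cls (sec f) \<in> cls ` carrier (poly_ring a)" for f using sec by blast
    show "\<phi> P (cls (sec f)) = f" if "P \<in> Y" for P f
      using that sec by (simp add: \<phi>_cls)
  qed
  show ?thesis unfolding arithmetically_CM_def by (rule cohen_macaulay)
qed

theorem lemma3p4:
  fixes a1 a2 :: nat
    and X :: "((nat \<Rightarrow> 'k::field_char_0) set \<times> (nat \<Rightarrow> 'k) set) set"
  assumes "X \<subseteq> proj_space a1 \<times> proj_space a2"
    and "finite X"
  shows "inclusion_property a2 X \<longleftrightarrow> star_property X"
proof -
  have fiber: "snd ` level_set X P = {Q. (P, Q) \<in> X}" for P
    by (force simp: level_set_def)
  have "arithmetically_CM a2 (snd ` level_set X P)" for P
    using assms by (intro finite_points_arithmetically_CM) (auto simp: level_set_def)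
  \<comment> \<open>Two fibres are incomparable exactly when some \<open>Q1\<close> lies over
    \<open>P1\<close> but not \<open>P2\<close> and some \<open>Q2\<close> over \<open>P2\<close>
    but not \<open>P1\<close>, which is a failure of the star property.\<close>
  moreover have "chain\<^sub>\<subseteq> ((\<lambda>P. snd ` level_set X P) ` fst ` X) \<longleftrightarrow> star_property X"
    unfolding fiber chain_subset_def star_property_def by force
  ultimately show ?thesis by (simp add: inclusion_property_def)
qed

end
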